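(* Define trees $T_i$, $i\ge1$, as follows: $T_1=T_2=K_2$, and for $i\ge2$, $T_{i+1}$ is the tree consisting of a copy $T$ of $T_{i-1}$ and a copy $T'$ of $T_i$ (vertex-disjoint), together with one new edge joining the root of $T$ to the root of $T'$. Here the root of $T_i$ is a vertex of maximum degree of $T_i$ (for $i\ge4$ this vertex is unique; for $i\le3$ one vertex of maximum degree is designated as root). Then $T_i$ is a global amoeba for every $i\ge1$.
   Context: For a graph $G$ on vertex set $V=\{v_1,\dots,v_n\}$ let $L_G=\{ij: v_iv_j\in E(G)\}$; for $\sigma\in S_n$, $G_\sigma$ is the graph on $V$ with $E(G_\sigma)=\{v_{\sigma^{-1}(i)}v_{\sigma^{-1}(j)}: ij\in L_G\}$. An edge-replacement $e\to e'$ ($e\in E(G)$, $e'\in E(\overline G)\cup\{e\}$) is feasible if $G-e+e'\cong G$. Let $R_G$ be the set of feasible replacements $rs\to kl$ (meaning $v_rv_s\to v_kv_l$), $S_G(rs\to kl)=\{\sigma\in S_n: G_\sigma=G-v_rv_s+v_kv_l\}$, and $S_G\le S_n$ the group generated by $\bigcup_{rs\to kl\in R_G}S_G(rs\to kl)$. $G$ is a local amoeba if $S_G=S_n$; $G$ is a global amoeba if there is $T\ge0$ such that $G\cup tK_1$ ($G$ plus $t$ isolated vertices) is a local amoeba for all $t\ge T$. *)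

theory Defs
  imports "HOL-Algebra.Sym_Groups"
begin

record 'a ugraph =
  verts :: "'a set"
  edges :: "'a set set"

definition simple_graph :: "'a ugraph \<Rightarrow> bool" where
  "simple_graph G \<longleftrightarrow> finite (verts G) \<and> (\<forall>e\<in>edges G. e \<subseteq> verts G \<and> card e = 2)"

definition graph_iso :: "'a ugraph \<Rightarrow> 'b ugraph \<Rightarrow> bool" where
  "graph_iso G H \<longleftrightarrow> (\<exists>f. bij_betw f (verts G) (verts H) \<and> edges H = (\<lambda>e. f ` e) ` edges G)"

definition complement :: "'a ugraph \<Rightarrow> 'a ugraph" where
  "complement G = \<lparr>verts = verts G,
                   edges = {e. e \<subseteq> verts G \<and> card e = 2 \<and> e \<notin> edges G}\<rparr>"

definition degree :: "'a ugraph \<Rightarrow> 'a \<Rightarrow> nat" where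
  "degree G x = card {e \<in> edges G. x \<in> e}"

definition max_degree_vertex :: "'a ugraph \<Rightarrow> 'a \<Rightarrow> bool" where
  "max_degree_vertex G x \<longleftrightarrow> x \<in> verts G \<and> (\<forall>y\<in>verts G. degree G y \<le> degree G x)"

definition replace_edge :: "'a ugraph \<Rightarrow> 'a set \<Rightarrow> 'a set \<Rightarrow> 'a ugraph" where
  "replace_edge G e e' = \<lparr>verts = verts G, edges = (edges G - {e}) \<union> {e'}\<rparr>"

definition feasible :: "'a ugraph \<Rightarrow> 'a set \<Rightarrow> 'a set \<Rightarrow> bool" where
  "feasible G e e' \<longleftrightarrow>
     e \<in> edges G \<and> e' \<in> edges (complement G) \<union> {e} \<and> graph_iso (replace_edge G e e') G"

text \<open>
  A labelling \<open>v\<close> lists the vertices as \<open>v 1, \<dots>, v n\<close>. An unordered pair of labels \<open>ij\<close> is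
  the set \<open>{i, j}\<close>, so the corresponding pair of vertices is its image under \<open>v\<close>.
\<close>

definition labelling :: "'a ugraph \<Rightarrow> (nat \<Rightarrow> 'a) \<Rightarrow> bool" where
  "labelling G v \<longleftrightarrow> bij_betw v {1..card (verts G)} (verts G)"

definition label_edges :: "'a ugraph \<Rightarrow> (nat \<Rightarrow> 'a) \<Rightarrow> nat set set" where
  "label_edges G v = {{i, j} | i j. i \<in> {1..card (verts G)} \<and> j \<in> {1..card (verts G)} \<and>
                                    {v i, v j} \<in> edges G}"

definition permuted_graph :: "'a ugraph \<Rightarrow> (nat \<Rightarrow> 'a) \<Rightarrow> (nat \<Rightarrow> nat) \<Rightarrow> 'a ugraph" where
  "permuted_graph G v \<sigma> =
     \<lparr>verts = verts G,
      edges = {{v (inv' \<sigma> i), v (inv' \<sigma> j)} | i j. {i, j} \<in> label_edges G v}\<rparr>"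

definition feasible_replacements :: "'a ugraph \<Rightarrow> (nat \<Rightarrow> 'a) \<Rightarrow> (nat set \<times> nat set) set" where
  "feasible_replacements G v =
     {(rs, kl). rs \<subseteq> {1..card (verts G)} \<and> kl \<subseteq> {1..card (verts G)} \<and>
                feasible G (v ` rs) (v ` kl)}"

definition replacement_perms ::
    "'a ugraph \<Rightarrow> (nat \<Rightarrow> 'a) \<Rightarrow> nat set \<times> nat set \<Rightarrow> (nat \<Rightarrow> nat) set" where
  "replacement_perms G v = (\<lambda>(rs, kl).
     {\<sigma> \<in> carrier (sym_group (card (verts G))).
        permuted_graph G v \<sigma> = replace_edge G (v ` rs) (v ` kl)})"

definition amoeba_group :: "'a ugraph \<Rightarrow> (nat \<Rightarrow> 'a) \<Rightarrow> (nat \<Rightarrow> nat) set" where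
  "amoeba_group G v =
     generate (sym_group (card (verts G)))
       (\<Union>rep\<in>feasible_replacements G v. replacement_perms G v rep)"

text \<open>
  Two labellings of the same graph give conjugate groups, so it does not matter which one is
  used; we ask for all of them.
\<close>

definition local_amoeba :: "'a ugraph \<Rightarrow> bool" where
  "local_amoeba G \<longleftrightarrow> simple_graph G \<and>
     (\<forall>v. labelling G v \<longrightarrow> amoeba_group G v = carrier (sym_group (card (verts G))))"

definition add_isolated :: "'a ugraph \<Rightarrow> nat \<Rightarrow> ('a + nat) ugraph" where
  "add_isolated G t = \<lparr>verts = Inl ` verts G \<union> Inr ` {..<t},
                       edges = (\<lambda>e. Inl ` e) ` edges G\<rparr>"

definition global_amoeba :: "'a ugraph \<Rightarrow> bool" where
  "global_amoeba G \<longleftrightarrow> (\<exists>T. \<forall>t\<ge>T. local_amoeba (add_isolated G t))"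

text \<open>
  \<open>fib_tree i G\<close> says that \<open>G\<close> is a copy of \<open>T\<^sub>i\<close>. The roots joined in the last rule are
  arbitrary vertices of maximum degree. For \<open>i \<le> 3\<close> such a vertex is not unique, but the
  automorphisms of \<open>T\<^sub>i\<close> act transitively on the candidates, so the choice does not affect the
  isomorphism type.
\<close>

inductive fib_tree :: "nat \<Rightarrow> 'a ugraph \<Rightarrow> bool" where
  one: "x \<noteq> y \<Longrightarrow> fib_tree 1 \<lparr>verts = {x, y}, edges = {{x, y}}\<rparr>"
| two: "x \<noteq> y \<Longrightarrow> fib_tree 2 \<lparr>verts = {x, y}, edges = {{x, y}}\<rparr>"
| join: "i \<ge> 2 \<Longrightarrow> fib_tree (i - 1) A \<Longrightarrow> fib_tree i B \<Longrightarrow> verts A \<inter> verts B = {} \<Longrightarrow>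
         max_degree_vertex A r \<Longrightarrow> max_degree_vertex B s \<Longrightarrow>
         fib_tree (i + 1) \<lparr>verts = verts A \<union> verts B,
                           edges = edges A \<union> edges B \<union> {{r, s}}\<rparr>"

lemma fib_tree_verts: "fib_tree i G \<Longrightarrow> finite (verts G) \<and> verts G \<noteq> {}"
  by (induction rule: fib_tree.induct) auto

lemma max_degree_vertex_exists:
  assumes "finite (verts G)" "verts G \<noteq> {}"
  shows "\<exists>r. max_degree_vertex G r"
proof -
  have "Max (degree G ` verts G) \<in> degree G ` verts G"
    using assms by (intro Max_in) auto
  then obtain r where "r \<in> verts G" "degree G r = Max (degree G ` verts G)" by auto
  then show ?thesis using assms unfolding max_degree_vertex_def by (metis Max_ge finite_imageI imageI)
qed

text \<open>Every \<open>T\<^sub>i\<close> has a copy on any infinite type, so \<open>fib_tree\<close> is not vacuous.\<close>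

lemma fib_tree_exists:
  assumes "infinite (UNIV :: 'a set)" "i \<ge> 1" "finite F"
  shows "\<exists>G :: 'a ugraph. fib_tree i G \<and> verts G \<inter> F = {}"
  using assms(2,3)
proof (induction i arbitrary: F rule: less_induct)
  case (less i)
  show ?case
  proof (cases "i \<le> 2")
    case True
    obtain x where x: "x \<notin> F" using ex_new_if_finite[OF assms(1) less.prems(2)] by blast
    obtain y where "y \<notin> insert x F"
      using ex_new_if_finite[OF assms(1), of "insert x F"] less.prems(2) by blast
    moreover have "i = 1 \<or> i = 2" using True less.prems by auto
    ultimately show ?thesis using x fib_tree.one[of x y] fib_tree.two[of x y]
      by (intro exI[of _ "\<lparr>verts = {x, y}, edges = {{x, y}}\<rparr>"]) auto
  next
    case False
    then have i: "i - 1 - 1 \<ge> 1" "i - 1 - 1 < i" "i - 1 \<ge> 1" "i - 1 < i" "i - 1 \<ge> 2" by linarith+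
    obtain A :: "'a ugraph" where A: "fib_tree (i - 1 - 1) A" "verts A \<inter> F = {}"
      using less.IH[OF i(2,1) less.prems(2)] by blast
    obtain B :: "'a ugraph" where B: "fib_tree (i - 1) B" "verts B \<inter> (F \<union> verts A) = {}"
      using less.IH[OF i(4,3), of "F \<union> verts A"] less.prems(2) fib_tree_verts[OF A(1)] by blast
    obtain r s where "max_degree_vertex A r" "max_degree_vertex B s"
      using max_degree_vertex_exists fib_tree_verts A(1) B(1) by metis
    then have "fib_tree (i - 1 + 1) \<lparr>verts = verts A \<union> verts B,
                                      edges = edges A \<union> edges B \<union> {{r, s}}\<rparr>"
      using A B i(5) by (intro fib_tree.join) auto
    moreover have "i - 1 + 1 = i" using False by simp
    ultimately show ?thesis using A B
      by (intro exI[of _ "\<lparr>verts = verts A \<union> verts B, edges = edges A \<union> edges B \<union> {{r, s}}\<rparr>"]) auto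
  qed
qed

end

theory Submission imports Defs begin

text \<open>
  Let \<open>T\<^sub>i\<close> be rooted at \<open>s\<close>, inside a vertex set \<open>W\<close> with at least one further vertex. The
  edge replacements whose permutation fixes \<open>s\<close> already generate all permutations of \<open>W - {s}\<close>.
  Indeed, in \<open>T\<^bsub>i+1\<^esub> = A + B + rs\<close> the vertices of one part together with the isolated ones
  can be permuted, by induction, with the other part kept fixed. The two sets of vertices
  obtained in this way overlap in an isolated vertex, so everything except \<open>r\<close> and \<open>s\<close> is
  permuted arbitrarily. It remains to move \<open>r\<close>, and at the end \<open>s\<close>. Both are done by moving a
  branch between two neighbouring copies. Suppose that \<open>A + C + rc\<close> is a copy of \<open>T\<^bsub>j+1\<^esub>\<close> with
  root \<open>r\<close> in \<open>A\<close>, and that another copy \<open>A'\<close> of \<open>T\<^sub>j\<close> with root \<open>r'\<close> is placed so that \<open>A + C\<close> and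
  \<open>A'\<close> hang at the same vertex, or are joined by \<open>rr'\<close>. Then replacing \<open>rc\<close> by \<open>r'c\<close> exchanges
  the roles of \<open>A\<close> and \<open>A'\<close>. In the smallest trees \<open>C\<close> may be missing, and the exchange is then an
  automorphism.
\<close>

section \<open>Rooted trees and their isomorphisms\<close>

text \<open>The root is carried along explicitly instead of being read off from degrees: a join
  keeps the root of the larger part. Vertex and edge sets are separate arguments, so that a part can
  be handled inside a larger vertex set.\<close>

inductive rfib :: "nat \<Rightarrow> 'a \<Rightarrow> 'a set \<Rightarrow> 'a set set \<Rightarrow> bool" where
  base1: "x \<noteq> y \<Longrightarrow> rfib (Suc 0) x {x, y} {{x, y}}"
| base2: "x \<noteq> y \<Longrightarrow> rfib (Suc (Suc 0)) x {x, y} {{x, y}}"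
| join: "rfib (Suc n) r A EA \<Longrightarrow> rfib (Suc (Suc n)) s B EB \<Longrightarrow> A \<inter> B = {} \<Longrightarrow>
         rfib (Suc (Suc (Suc n))) s (A \<union> B) (EA \<union> EB \<union> {{r, s}})"

lemma rfib_basic:
  assumes "rfib n s V E"
  shows "finite V" "s \<in> V" "\<And>e. e \<in> E \<Longrightarrow> e \<subseteq> V" "\<And>e. e \<in> E \<Longrightarrow> card e = 2"
    "finite E" "E \<noteq> {}" "V \<noteq> {s}"
  using assms
proof (induction rule: rfib.induct)
  case (join n r A EA s B EB)
  then have "r \<noteq> s" by blast
  { case 1 show ?case using join by simp }
  { case 2 show ?case using join by simp }
  { case 3 then show ?case using join by blast }
  { case 4 then show ?case using join \<open>r \<noteq> s\<close> by auto }
  { case 5 show ?case using join by simp }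
  { case 6 show ?case by simp }
  { case 7 show ?case using join \<open>r \<noteq> s\<close> by blast }
qed auto

lemma rfib_1_cases:
  assumes "rfib (Suc 0) s V E"
  obtains y where "s \<noteq> y" "V = {s, y}" "E = {{s, y}}"
  using assms by (cases rule: rfib.cases) auto

lemma rfib_2_cases:
  assumes "rfib (Suc (Suc 0)) s V E"
  obtains y where "s \<noteq> y" "V = {s, y}" "E = {{s, y}}"
  using assms by (cases rule: rfib.cases) auto

lemma rfib_join_cases:
  assumes "rfib (Suc (Suc (Suc n))) s V E"
  obtains r A EA B EB where "rfib (Suc n) r A EA" "rfib (Suc (Suc n)) s B EB" "A \<inter> B = {}"
    "V = A \<union> B" "E = EA \<union> EB \<union> {{r, s}}"
  using assms by (cases rule: rfib.cases) auto

text \<open>T_1 and T_2 are both a single edge, so a part of index 1 can be exchanged with one of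
  index 2 by results that require equal indices.\<close>

lemma rfib_1_iff_2: "rfib (Suc 0) s V E \<longleftrightarrow> rfib (Suc (Suc 0)) s V E"
  by (auto elim!: rfib_1_cases rfib_2_cases intro: base1 base2)

definition rooted_iso :: "'a \<Rightarrow> 'a set \<Rightarrow> 'a set set \<Rightarrow> 'b \<Rightarrow> 'b set \<Rightarrow> 'b set set \<Rightarrow> ('a \<Rightarrow> 'b) \<Rightarrow> bool" where
  "rooted_iso r V E r' V' E' f \<longleftrightarrow> bij_betw f V V' \<and> f r = r' \<and> E' = image f ` E"

text \<open>Isomorphisms of the two parts glue over the disjoint vertex sets; since they match the
  roots of the parts, the joining edge is matched as well.\<close>

lemma rfib_rooted_iso:
  assumes "rfib n s V E" "rfib n s' V' E'"
  shows "\<exists>f. rooted_iso s V E s' V' E' f"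
  using assms
proof (induction arbitrary: s' V' E' rule: rfib.induct)
  case (base1 x y)
  from base1.prems obtain z where "s' \<noteq> z" "V' = {s', z}" "E' = {{s', z}}" by (rule rfib_1_cases)
  then show ?case using base1.hyps unfolding rooted_iso_def
    by (intro exI[of _ "\<lambda>w. if w = x then s' else z"]) (auto simp: bij_betw_def)
next
  case (base2 x y)
  from base2.prems obtain z where "s' \<noteq> z" "V' = {s', z}" "E' = {{s', z}}"
    by (rule rfib_2_cases)
  then show ?case using base2.hyps unfolding rooted_iso_def
    by (intro exI[of _ "\<lambda>w. if w = x then s' else z"]) (auto simp: bij_betw_def)
next
  case (join n r A EA s B EB)
  from join.prems obtain r' A' EA' B' EB' where
    *: "rfib (Suc n) r' A' EA'" "rfib (Suc (Suc n)) s' B' EB'" "A' \<inter> B' = {}"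
    "V' = A' \<union> B'" "E' = EA' \<union> EB' \<union> {{r', s'}}" by (rule rfib_join_cases)
  obtain f g where f: "rooted_iso r A EA r' A' EA' f" and g: "rooted_iso s B EB s' B' EB' g"
    using join.IH *(1,2) by blast
  note b = rfib_basic[OF join.hyps(1)] rfib_basic[OF join.hyps(2)]
  define h where "h x = (if x \<in> A then f x else g x)" for x
  have hB: "h x = g x" if "x \<in> B" for x using that join.hyps(3) by (auto simp: h_def)
  have "bij_betw h A A'" "bij_betw h B B'"
    using f g hB bij_betw_cong[of A h f] bij_betw_cong[of B h g]
    by (auto simp: rooted_iso_def h_def)
  then have "bij_betw h (A \<union> B) (A' \<union> B')" using *(3) by (rule bij_betw_combine)
  moreover have "image h ` EA = EA'"
  proof -
    have "image h ` EA = image f ` EA"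
      using b(3) by (intro image_cong refl) (auto simp: h_def)
    then show ?thesis using f by (simp add: rooted_iso_def)
  qed
  moreover have "image h ` EB = EB'"
  proof -
    have "image h ` EB = image g ` EB"
      using b(10) by (intro image_cong refl) (auto simp: hB subset_iff)
    then show ?thesis using g by (simp add: rooted_iso_def)
  qed
  moreover have "h s = s'" "h r = r'"
    using f g b hB by (auto simp: rooted_iso_def h_def)
  ultimately have "rooted_iso s (A \<union> B) (EA \<union> EB \<union> {{r, s}}) s' V' E' h"
    unfolding rooted_iso_def * by (simp add: image_Un)
  then show ?case by blast
qed

lemma rfib_image:
  assumes "rfib n s V E" "inj f"
  shows "rfib n (f s) (f ` V) (image f ` E)"
  using assms(1)
proof (induction rule: rfib.induct)
  case (base1 x y)
  then show ?case using rfib.base1[of "f x" "f y"] assms(2) by (auto dest: injD)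
next
  case (base2 x y)
  then show ?case using rfib.base2[of "f x" "f y"] assms(2) by (auto dest: injD)
next
  case (join n r A EA s B EB)
  have "f ` A \<inter> f ` B = {}" using join.hyps assms(2) by (auto dest: injD)
  from rfib.join[OF join.IH this] show ?case by (simp add: image_Un)
qed

text \<open>On \<open>X\<close> take the isomorphism, on \<open>X'\<close> its inverse, elsewhere
  the identity. The result exchanges the two copies and is defined on the whole type.\<close>

lemma rooted_iso_swap:
  assumes f: "rooted_iso r X D r' X' D' f" and disj: "X \<inter> X' = {}" and r: "r \<in> X"
    and D: "\<And>e. e \<in> D \<Longrightarrow> e \<subseteq> X"
  obtains p where "p permutes X \<union> X'" "p r = r'" "p r' = r"
    "image p ` D = D'" "image p ` D' = D"
proof -
  have bij: "bij_betw f X X'" and fr: "f r = r'" and E': "D' = image f ` D"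
    using f by (auto simp: rooted_iso_def)
  define g where "g = inv_into X f"
  define p where "p x = (if x \<in> X then f x else if x \<in> X' then g x else x)" for x
  have bg: "bij_betw g X' X" using bij by (simp add: g_def bij_betw_inv_into)
  have gf: "g (f x) = x" if "x \<in> X" for x
    using bij that by (simp add: g_def bij_betw_inv_into_left)
  have pX: "p x = f x" if "x \<in> X" for x using that by (simp add: p_def)
  have pX': "p x = g x" if "x \<in> X'" for x using that disj by (auto simp: p_def)
  have fX: "f x \<in> X'" if "x \<in> X" for x using bij that by (auto simp: bij_betw_def)
  have "bij_betw p X X'" "bij_betw p X' X"
    using bij bg bij_betw_cong[of X p f] bij_betw_cong[of X' p g] pX pX' by auto
  then have "bij_betw p (X \<union> X') (X' \<union> X)" using disj by (intro bij_betw_combine) auto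
  then have "p permutes X \<union> X'"
    by (intro bij_imp_permutes) (auto simp: Un_commute p_def)
  moreover have "image p ` D = D'"
    unfolding E' using D pX by (intro image_cong refl) blast+
  moreover have "image p ` D' = D"
  proof -
    have "p ` f ` e = e" if "e \<in> D" for e
    proof -
      have "p (f x) = x" if "x \<in> e" for x
        using that D[OF \<open>e \<in> D\<close>] pX' fX gf by (metis subsetD)
      then show ?thesis by (simp add: image_comp)
    qed
    then show ?thesis unfolding E' by (simp add: image_comp)
  qed
  moreover have "p r = r'" "p r' = r" using r fr pX pX' fX gf by auto
  ultimately show ?thesis using that by blast
qed

section \<open>Permutations realised by edge replacements\<close>

text \<open>
  The conditions that \<open>feasible\<close> puts on \<open>e'\<close> need not be required here: \<open>e'\<close> is the image of an
  edge, and \<open>p\<close> preserves the number of edges.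
\<close>

definition step_perms :: "'a set set \<Rightarrow> 'a set \<Rightarrow> ('a \<Rightarrow> 'a) set" where
  "step_perms E U = {p. p permutes U \<and> (\<exists>e\<in>E. \<exists>e'. image p ` E = E - {e} \<union> {e'})}"

text \<open>This is the label-free counterpart of \<open>amoeba_group\<close>. The set
  \<open>U\<close> confines the moved vertices, so that one part of a tree can be permuted while the
  rest stays fixed.\<close>

inductive_set step_group :: "'a set set \<Rightarrow> 'a set \<Rightarrow> ('a \<Rightarrow> 'a) set" for E U where
  step_id: "id \<in> step_group E U"
| step: "p \<in> step_perms E U \<Longrightarrow> p \<in> step_group E U"
| comp: "p \<in> step_group E U \<Longrightarrow> q \<in> step_group E U \<Longrightarrow> p \<circ> q \<in> step_group E U"
| inv: "p \<in> step_group E U \<Longrightarrow> inv' p \<in> step_group E U"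

lemma step_permsE:
  assumes "p \<in> step_perms E U"
  obtains e e' where "p permutes U" "e \<in> E" "image p ` E = E - {e} \<union> {e'}"
  using assms unfolding step_perms_def mem_Collect_eq by (elim conjE bexE exE) rule

text \<open>An automorphism \<open>p\<close> of what remains after deleting \<open>e\<close>
  realises the replacement of \<open>e\<close> by its image under \<open>p\<close>.\<close>

lemma step_permsI:
  assumes "p permutes U" "e \<notin> F" "image p ` F = F"
  shows "p \<in> step_perms (F \<union> {e}) U"
proof -
  have "image p ` (F \<union> {e}) = (F \<union> {e}) - {e} \<union> {p ` e}"
    using assms(2,3) by (simp add: image_Un)
  then show ?thesis using assms(1) unfolding step_perms_def by blast
qed

text \<open>Automorphisms realise the trivial replacement of an edge by itself, for which some edge
  must exist.\<close>

lemma step_permsI_aut: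
  assumes "p permutes U" "E \<noteq> {}" "image p ` E = E"
  shows "p \<in> step_perms E U"
proof -
  obtain e where "e \<in> E" using assms(2) by blast
  then have "image p ` E = E - {e} \<union> {e}" using assms(3) by auto
  then show ?thesis using assms(1) \<open>e \<in> E\<close> unfolding step_perms_def by blast
qed

lemma step_group_permutes: "p \<in> step_group E U \<Longrightarrow> p permutes U"
proof (induction rule: step_group.induct)
  case step_id
  show ?case by (rule permutes_id)
next
  case (step p)
  then show ?case by (simp add: step_perms_def)
next
  case (comp p q)
  show ?case using comp.IH(2,1) by (rule permutes_compose)
next
  case (inv p)
  show ?case using inv.IH by (rule permutes_inv)
qed

lemma step_group_mono:
  assumes "U \<subseteq> U'" "p \<in> step_group E U"
  shows "p \<in> step_group E U'"
  using assms(2)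
proof (induction rule: step_group.induct)
  case (step p)
  then show ?case using assms(1)
    by (intro step_group.step) (auto simp: step_perms_def intro: permutes_subset)
next
  case step_id
  show ?case by (rule step_group.step_id)
next
  case (comp p q)
  show ?case using comp.IH by (rule step_group.comp)
next
  case (inv p)
  show ?case using inv.IH by (rule step_group.inv)
qed

lemma permutes_image_disjoint: "p permutes U \<Longrightarrow> e \<inter> U = {} \<Longrightarrow> p ` e = e"
proof -
  assume p: "p permutes U" and "e \<inter> U = {}"
  then have "p x = x" if "x \<in> e" for x using that by (intro permutes_not_in[OF p]) blast
  then show "p ` e = e" by simp
qed

lemma permutes_image_fixed:
  assumes "p permutes U" "\<And>e. e \<in> C \<Longrightarrow> e \<inter> U = {}"
  shows "image p ` C = C"
proof -
  have "image p ` C = (\<lambda>e. e) ` C"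
    by (intro image_cong refl permutes_image_disjoint[OF assms(1)] assms(2))
  then show ?thesis by simp
qed

text \<open>Edges that avoid \<open>U\<close> are fixed by every permutation of \<open>U\<close>, so
  they can be added to both sides of a replacement. This carries the induction hypothesis from a
  part to the whole tree.\<close>

lemma step_group_lift:
  assumes "\<And>e. e \<in> C \<Longrightarrow> e \<inter> U = {}" "E \<inter> C = {}" "p \<in> step_group E U"
  shows "p \<in> step_group (E \<union> C) U"
  using assms(3)
proof (induction rule: step_group.induct)
  case (step p)
  obtain e e' where p: "p permutes U" "e \<in> E" "image p ` E = E - {e} \<union> {e'}"
    using step.hyps by (rule step_permsE)
  have "image p ` (E \<union> C) = (E \<union> C) - {e} \<union> {e'}"
  proof -
    have "e \<notin> C" using p(2) assms(2) by blast
    moreover have "image p ` C = C" using p(1) assms(1) by (rule permutes_image_fixed)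
    ultimately show ?thesis by (simp add: image_Un p(3) Un_Diff)
  qed
  moreover have "e \<in> E \<union> C" using p(2) by simp
  ultimately have "p \<in> step_perms (E \<union> C) U"
    using p(1) unfolding step_perms_def mem_Collect_eq by (intro conjI bexI exI)
  then show ?case by (rule step_group.step)
next
  case step_id
  show ?case by (rule step_group.step_id)
next
  case (comp p q)
  show ?case using comp.IH by (rule step_group.comp)
next
  case (inv p)
  show ?case using inv.IH by (rule step_group.inv)
qed

section \<open>Transpositions in the group\<close>

text \<open>This is an equivalence relation. Once all vertices are equivalent, the group contains
  every transposition and is therefore the full symmetric group.\<close>

definition swappable :: "'a set set \<Rightarrow> 'a set \<Rightarrow> 'a \<Rightarrow> 'a \<Rightarrow> bool" where
  "swappable E U a b \<longleftrightarrow> transpose a b \<in> step_group E U"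

lemma swappable_refl [simp]: "swappable E U a a"
  unfolding swappable_def transpose_same by (rule step_group.step_id)

lemma swappable_sym: "swappable E U a b \<Longrightarrow> swappable E U b a"
  by (simp add: swappable_def transpose_commute)

lemma swappable_conj:
  assumes "g \<in> step_group E U" "swappable E U a b"
  shows "swappable E U (g a) (g b)"
proof -
  have "bij g" using step_group_permutes[OF assms(1)] by (rule permutes_bij)
  have "g \<circ> transpose a b \<circ> inv' g = transpose (g a) (g b)"
  proof
    fix x
    obtain y where x: "x = g y" using bij_is_surj[OF \<open>bij g\<close>] by (rule surjE)
    have "inv' g x = y" unfolding x by (rule inv_f_f[OF bij_is_inj[OF \<open>bij g\<close>]])
    then show "(g \<circ> transpose a b \<circ> inv' g) x = transpose (g a) (g b) x"
      using inj_eq[OF bij_is_inj[OF \<open>bij g\<close>]] by (simp add: x transpose_def)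
  qed
  moreover have "g \<circ> transpose a b \<circ> inv' g \<in> step_group E U"
    using assms unfolding swappable_def
    by (intro step_group.comp step_group.inv)
  ultimately show ?thesis by (simp only: swappable_def)
qed

text \<open>Conjugating (a b) by (b c) gives (a c) when a differs from b and c.\<close>

lemma swappable_trans:
  assumes "swappable E U a b" "swappable E U b c"
  shows "swappable E U a c"
proof (cases "a = b \<or> a = c")
  case False
  have "swappable E U (transpose b c a) (transpose b c b)"
    using assms(2,1) unfolding swappable_def[of E U b c] by (rule swappable_conj)
  then show ?thesis using False by (simp add: transpose_def split: if_splits)
qed (use assms in auto)

lemma swappable_mono: "U \<subseteq> U' \<Longrightarrow> swappable E U a b \<Longrightarrow> swappable E U' a b"
  unfolding swappable_def by (rule step_group_mono)

text \<open>Some \<open>c\<close> in \<open>S\<close> is sent to \<open>x\<close> by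
  \<open>g\<close>. For another \<open>d\<close> in \<open>S\<close>, conjugating (c d) by
  \<open>g\<close> gives the transposition of \<open>x\<close> and \<open>g d\<close>, and
  \<open>g d\<close> lies in \<open>S\<close>; this links \<open>x\<close> to \<open>S\<close>. Two
  elements of \<open>S\<close> are used, which is what the condition on singletons provides.\<close>

lemma swappable_extend:
  assumes sw: "\<And>a b. a \<in> S \<Longrightarrow> b \<in> S \<Longrightarrow> swappable E (insert x S) a b"
    and g: "g \<in> step_group E (insert x S)" "g x \<noteq> x"
    and S: "\<not> (\<exists>y. S \<subseteq> {y})" and ab: "a \<in> insert x S" "b \<in> insert x S"
  shows "swappable E (insert x S) a b"
proof -
  have p: "g permutes insert x S" by (rule step_group_permutes[OF g(1)])
  obtain c where c: "c \<in> insert x S" "g c = x"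
    using permutes_image[OF p] by (metis imageE insertI1)
  then have "c \<in> S" using g(2) by auto
  obtain d where d: "d \<in> S" "d \<noteq> c" using S by blast
  have "g d \<noteq> x" using c(2) d(2) permutes_inj[OF p] by (metis injD)
  moreover have "g d \<in> insert x S" using d(1) permutes_in_image[OF p] by blast
  ultimately have gd: "g d \<in> S" by simp
  have x: "swappable E (insert x S) x (g d)"
    using swappable_conj[OF g(1) sw[OF \<open>c \<in> S\<close> d(1)]] c(2) by simp
  have "swappable E (insert x S) y (g d)" if "y \<in> insert x S" for y
  proof (cases "y = x")
    case True
    then show ?thesis using x by simp
  next
    case False
    then show ?thesis using that by (intro sw gd) simp
  qed
  from swappable_trans[OF this[OF ab(1)] swappable_sym[OF this[OF ab(2)]]] show ?thesis .
qed

section \<open>Moving the root and its neighbour by branch exchanges\<close>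

lemma rfib_swap:
  assumes "rfib n r X D" "rfib n r' X' D'" "X \<inter> X' = {}"
  obtains p where "p permutes X \<union> X'" "p r = r'" "p r' = r" "image p ` D = D'" "image p ` D' = D"
proof -
  obtain f where "rooted_iso r X D r' X' D' f" using rfib_rooted_iso[OF assms(1,2)] by blast
  from rooted_iso_swap[OF this assms(3) rfib_basic(2,3)[OF assms(1)] that] show ?thesis .
qed

text \<open>The larger part minus its own smaller branch is a copy of the smaller part, joined to it
  by \<open>rs\<close>. Moving that branch across \<open>rs\<close> exchanges the two copies and
  thus the roots \<open>r\<close> and \<open>s\<close>. Up to T_3 there is no such branch, and the
  move is an automorphism.\<close>

lemma rfib_move_root:
  assumes "rfib n s V E"
  shows "\<exists>p\<in>step_perms E V. p s \<noteq> s"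
proof -
  have K2: "\<exists>p\<in>step_perms E V. p s \<noteq> s" if "s \<noteq> y" "V = {s, y}" "E = {{s, y}}" for y
    using that by (intro bexI[of _ "transpose s y"] step_permsI_aut permutes_swap_id) auto
  consider "n = Suc 0" | "n = Suc (Suc 0)" | "n = Suc (Suc (Suc 0))" | m where "n = Suc (Suc (Suc (Suc m)))"
  proof -
    have "n \<noteq> 0" using assms by (cases rule: rfib.cases) auto
    then show ?thesis using that by (metis nat.exhaust)
  qed
  then show ?thesis
  proof cases
    case 1
    obtain y where "s \<noteq> y" "V = {s, y}" "E = {{s, y}}"
      using assms unfolding 1 by (rule rfib_1_cases)
    then show ?thesis by (rule K2)
  next
    case 2
    obtain y where "s \<noteq> y" "V = {s, y}" "E = {{s, y}}"
      using assms unfolding 2 by (rule rfib_2_cases)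
    then show ?thesis by (rule K2)
  next
    case 3
    obtain r A EA B EB where *: "rfib (Suc 0) r A EA" "rfib (Suc (Suc 0)) s B EB" "A \<inter> B = {}"
      "V = A \<union> B" "E = EA \<union> EB \<union> {{r, s}}"
      using assms unfolding 3 by (rule rfib_join_cases)
    \<comment> \<open>T_3 is a path with four vertices, and \<open>p\<close> reverses it.\<close>
    obtain p where p: "p permutes A \<union> B" "p r = s" "p s = r"
      "image p ` EA = EB" "image p ` EB = EA"
      by (rule rfib_swap[OF *(1)[unfolded rfib_1_iff_2] *(2,3)])
    have "image p ` E = E" unfolding *(5) image_Un p(4,5) by (auto simp: p(2,3))
    then have "p \<in> step_perms E V"
      using p(1) by (intro step_permsI_aut) (simp_all add: *(4,5))
    moreover have "r \<noteq> s" using *(3) rfib_basic(2)[OF *(1)] rfib_basic(2)[OF *(2)] by blast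
    ultimately show ?thesis using p(3) by blast
  next
    case (4 m)
    obtain r A EA B EB where *: "rfib (Suc (Suc m)) r A EA" "rfib (Suc (Suc (Suc m))) s B EB"
      "A \<inter> B = {}" "V = A \<union> B" "E = EA \<union> EB \<union> {{r, s}}"
      using assms unfolding 4 by (rule rfib_join_cases)
    obtain r1 A1 E1 B1 EB1 where **: "rfib (Suc m) r1 A1 E1" "rfib (Suc (Suc m)) s B1 EB1"
      "A1 \<inter> B1 = {}" "B = A1 \<union> B1" "EB = E1 \<union> EB1 \<union> {{r1, s}}"
      using *(2) by (rule rfib_join_cases)
    \<comment> \<open>\<open>A\<close> and \<open>B1\<close> are both copies of T_{m+2}, with
      adjacent roots \<open>r\<close> and \<open>s\<close>. The branch \<open>A1\<close> stays in
      place, and its edge to \<open>s\<close> is replaced by an edge to \<open>r\<close>.\<close>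
    have disj: "A \<inter> B1 = {}" using *(3) **(4) by blast
    obtain p where p: "p permutes A \<union> B1" "p r = s" "p s = r"
      "image p ` EA = EB1" "image p ` EB1 = EA"
      by (rule rfib_swap[OF *(1) **(2) disj])
    note roots = rfib_basic(2)[OF *(1)] rfib_basic(2)[OF **(1)] rfib_basic(2)[OF **(2)]
    note edges = rfib_basic(3)[OF *(1)] rfib_basic(3)[OF **(1)] rfib_basic(3)[OF **(2)]
    let ?F = "EA \<union> EB1 \<union> E1 \<union> {{r, s}}"
    have "image p ` E1 = E1"
      using p(1) by (rule permutes_image_fixed) (use edges(2) *(3) **(3,4) in blast)
    then have "image p ` ?F = ?F" unfolding image_Un p(4,5) by (auto simp: p(2,3))
    moreover have "{r1, s} \<notin> ?F"
    proof -
      have "r1 \<noteq> r" "r1 \<noteq> s" "s \<notin> A" "s \<notin> A1" "r1 \<notin> B1" using roots *(3) **(3,4) by blast+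
      moreover from this have "{r1, s} \<notin> EA" "{r1, s} \<notin> E1" "{r1, s} \<notin> EB1"
        using edges(1-3)[of "{r1, s}"] by blast+
      ultimately show ?thesis by (auto simp: doubleton_eq_iff)
    qed
    moreover have "p permutes V" using p(1) *(4) **(4) by (auto intro: permutes_subset)
    ultimately have "p \<in> step_perms (?F \<union> {{r1, s}}) V" by (intro step_permsI)
    moreover have "?F \<union> {{r1, s}} = E" unfolding *(5) **(5) by blast
    moreover have "r \<noteq> s" using disj roots by blast
    ultimately show ?thesis using p(3) by auto
  qed
qed

text \<open>The exchange takes place between branches hanging at \<open>s\<close>, so
  \<open>s\<close> itself stays fixed, as the induction over parts requires: a part touches the rest
  of the tree only at its root.\<close>

lemma rfib_move_child:
  assumes A: "rfib (Suc n) r A EA" and B: "rfib (Suc (Suc n)) s B EB" and AB: "A \<inter> B = {}"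
  shows "\<exists>p\<in>step_perms (EA \<union> EB \<union> {{r, s}}) (A \<union> B - {s}). p r \<noteq> r"
proof -
  consider "n = 0" | "n = Suc 0" | m where "n = Suc (Suc m)" by (metis nat.exhaust)
  then show ?thesis
  proof cases
    case 1
    obtain c where c: "r \<noteq> c" "A = {r, c}" "EA = {{r, c}}" using A unfolding 1 by (rule rfib_1_cases)
    obtain a where a: "s \<noteq> a" "B = {s, a}" "EB = {{s, a}}" using B unfolding 1 by (rule rfib_2_cases)
    have ne: "r \<noteq> s" "r \<noteq> a" "c \<noteq> s" "c \<noteq> a" using AB c(2) a(2) by auto
    \<comment> \<open>T_3 is the path c, r, s, a. Without the edge \<open>rc\<close>, exchanging
      \<open>r\<close> and \<open>a\<close> only flips the path r, s, a about its middle;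
      \<open>rc\<close> becomes \<open>ac\<close>.\<close>
    have "transpose r a \<in> step_perms ({{s, a}, {r, s}} \<union> {{r, c}}) (A \<union> B - {s})"
    proof (rule step_permsI)
      show "transpose r a permutes A \<union> B - {s}"
        using ne a c by (intro permutes_swap_id) auto
      show "{r, c} \<notin> {{s, a}, {r, s}}" using ne by (auto simp: doubleton_eq_iff)
      show "image (transpose r a) ` {{s, a}, {r, s}} = {{s, a}, {r, s}}"
        using ne a(1) by (auto simp: transpose_def)
    qed
    moreover have "{{s, a}, {r, s}} \<union> {{r, c}} = EA \<union> EB \<union> {{r, s}}" using a c by blast
    ultimately show ?thesis using ne(2) by (metis transpose_apply_first)
  next
    case 2
    obtain r1 A1 E1 B1 EB1 where *: "rfib (Suc 0) r1 A1 E1" "rfib (Suc (Suc 0)) s B1 EB1"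
      "A1 \<inter> B1 = {}" "B = A1 \<union> B1" "EB = E1 \<union> EB1 \<union> {{r1, s}}"
      using B unfolding 2 by (rule rfib_join_cases)
    have A': "rfib (Suc 0) r A EA" using A unfolding 2 by (simp add: rfib_1_iff_2)
    \<comment> \<open>\<open>A\<close> and \<open>A1\<close> are single edges hanging at
      \<open>s\<close>, so exchanging them is an automorphism.\<close>
    have disj: "A \<inter> A1 = {}" using AB *(4) by blast
    obtain p where p: "p permutes A \<union> A1" "p r = r1" "p r1 = r"
      "image p ` EA = E1" "image p ` E1 = EA"
      by (rule rfib_swap[OF A' *(1) disj])
    note roots = rfib_basic(2)[OF A] rfib_basic(2)[OF *(1)] rfib_basic(2)[OF *(2)]
    have "image p ` EB1 = EB1"
      using p(1) by (rule permutes_image_fixed) (use rfib_basic(3)[OF *(2)] *(3,4) AB in blast)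
    moreover have s: "s \<notin> A \<union> A1" using AB roots *(3,4) by blast
    moreover have "p s = s" using p(1) s by (rule permutes_not_in)
    ultimately have "image p ` (EA \<union> EB \<union> {{r, s}}) = EA \<union> EB \<union> {{r, s}}"
      unfolding *(5) image_Un p(4,5) by (auto simp: p(2,3))
    moreover have "p permutes A \<union> B - {s}"
      using p(1) by (rule permutes_subset) (use s *(4) in blast)
    ultimately have "p \<in> step_perms (EA \<union> EB \<union> {{r, s}}) (A \<union> B - {s})"
      by (intro step_permsI_aut) auto
    moreover have "r1 \<noteq> r" using disj roots by blast
    ultimately show ?thesis using p(2) by blast
  next
    case (3 m)
    obtain r1 A1 E1 B1 EB1 where *: "rfib (Suc (Suc m)) r1 A1 E1" "rfib (Suc (Suc (Suc m))) s B1 EB1"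
      "A1 \<inter> B1 = {}" "B = A1 \<union> B1" "EB = E1 \<union> EB1 \<union> {{r1, s}}"
      using B unfolding 3 by (rule rfib_join_cases)
    obtain r2 A2 E2 B2 EB2 where **: "rfib (Suc m) r2 A2 E2" "rfib (Suc (Suc m)) r B2 EB2"
      "A2 \<inter> B2 = {}" "A = A2 \<union> B2" "EA = E2 \<union> EB2 \<union> {{r2, r}}"
      using A unfolding 3 by (rule rfib_join_cases)
    \<comment> \<open>\<open>A\<close> and \<open>A1\<close> hang at \<open>s\<close>, and
      \<open>A\<close> without its branch \<open>A2\<close> is \<open>B2\<close>, a copy of T_{m+2}
      like \<open>A1\<close>. Deleting the edge from \<open>r2\<close> to \<open>r\<close> leaves a
      graph in which \<open>B2\<close> and \<open>A1\<close> can be exchanged; \<open>A2\<close> is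
      then attached to \<open>r1\<close>.\<close>
    have disj: "B2 \<inter> A1 = {}" using AB *(4) **(4) by blast
    obtain p where p: "p permutes B2 \<union> A1" "p r = r1" "p r1 = r"
      "image p ` EB2 = E1" "image p ` E1 = EB2"
      by (rule rfib_swap[OF **(2) *(1) disj])
    note roots = rfib_basic(2)[OF *(1)] rfib_basic(2)[OF *(2)] rfib_basic(2)[OF **(1)] rfib_basic(2)[OF **(2)]
    note edges = rfib_basic(3)[OF *(1)] rfib_basic(3)[OF *(2)] rfib_basic(3)[OF **(1)] rfib_basic(3)[OF **(2)]
    let ?F = "E2 \<union> EB2 \<union> E1 \<union> EB1 \<union> {{r1, s}, {r, s}}"
    have 1: "image p ` E2 = E2"
      using p(1) by (rule permutes_image_fixed) (use edges(3) AB *(4) **(3,4) in blast)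
    have 2: "image p ` EB1 = EB1"
      using p(1) by (rule permutes_image_fixed) (use edges(2) AB *(3,4) **(4) in blast)
    have s: "s \<notin> B2 \<union> A1" using AB roots *(3,4) **(4) by blast
    have "p s = s" using p(1) s by (rule permutes_not_in)
    then have "image p ` ?F = ?F" unfolding image_Un p(4,5) 1 2 by (auto simp: p(2,3))
    moreover have "{r2, r} \<notin> ?F"
    proof -
      have "r \<notin> A2" "r2 \<notin> B2" "r \<notin> A1" "r \<notin> B1" "r2 \<noteq> s" "r \<noteq> s"
        using roots AB *(3,4) **(3,4) by blast+
      moreover from this have "{r2, r} \<notin> E1" "{r2, r} \<notin> EB1" "{r2, r} \<notin> E2" "{r2, r} \<notin> EB2"
        using edges(1-4)[of "{r2, r}"] by blast+
      ultimately show ?thesis by (auto simp: doubleton_eq_iff)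
    qed
    moreover have "p permutes A \<union> B - {s}"
      using p(1) by (rule permutes_subset) (use s *(4) **(4) in blast)
    ultimately have "p \<in> step_perms (?F \<union> {{r2, r}}) (A \<union> B - {s})" by (intro step_permsI)
    moreover have "?F \<union> {{r2, r}} = EA \<union> EB \<union> {{r, s}}" unfolding *(5) **(5) by blast
    moreover have "r1 \<noteq> r" using disj roots by blast
    ultimately show ?thesis using p(2) by auto
  qed
qed

section \<open>All transpositions in the presence of a spare vertex\<close>

lemma swappable_lift:
  assumes "swappable E U a b" "\<And>e. e \<in> C \<Longrightarrow> e \<inter> U = {}" "E \<inter> C = {}" "U \<subseteq> U'"
  shows "swappable (E \<union> C) U' a b"
proof -
  have "swappable (E \<union> C) U a b"
    unfolding swappable_def
    using assms(2,3) assms(1)[unfolded swappable_def] by (rule step_group_lift)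
  with assms(4) show ?thesis by (rule swappable_mono)
qed

text \<open>Deleting the only edge leaves no edges, which every permutation preserves. This settles
  the two single-edge trees.\<close>

lemma single_edge_swappable:
  assumes "a \<in> U" "b \<in> U"
  shows "swappable {e} U a b"
proof -
  have "transpose a b \<in> step_perms ({} \<union> {e}) U"
    using assms by (intro step_permsI permutes_swap_id) auto
  then show ?thesis unfolding swappable_def by (intro step_group.step) simp
qed

text \<open>The set \<open>W\<close> varies in the induction: each part is treated in
  \<open>W\<close> without the other part, and the vertices outside the tree are shared by both.
  Fixing the root keeps the joining edge untouched.\<close>

lemma rfib_swappable_nonroot:
  assumes "rfib n s V E" "V \<subset> W" "a \<in> W - {s}" "b \<in> W - {s}"
  shows "swappable E (W - {s}) a b"
  using assms
proof (induction arbitrary: W a b rule: rfib.induct)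
  case (join n r A EA s B EB)
  note rA = rfib_basic[OF join.hyps(1)] and sB = rfib_basic[OF join.hyps(2)]
  let ?E = "EA \<union> EB \<union> {{r, s}}"
  \<comment> \<open>Besides \<open>s\<close>, also \<open>r\<close> is set aside at first, because
    the induction hypothesis for \<open>A\<close> fixes its root.\<close>
  let ?S = "W - {s} - {r}"
  \<comment> \<open>The spare vertex \<open>z\<close> belongs to both \<open>W - B\<close> and
    \<open>W - A\<close>. It keeps the inclusions of the parts strict and links the two
    classes.\<close>
  obtain z where z: "z \<in> W" "z \<notin> A" "z \<notin> B" using join.prems(1) by blast
  have rs: "r \<notin> B" "s \<notin> A" "r \<noteq> s" using rA(2) sB(2) join.hyps(3) by blast+
  have ins: "insert r ?S = W - {s}" using rA(2) rs join.prems(1) by blast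
  have EAB: "EA \<inter> EB = {}"
  proof -
    have "e = {}" if "e \<in> EA" "e \<in> EB" for e
      using rA(3)[OF that(1)] sB(3)[OF that(2)] join.hyps(3) by blast
    moreover have "{} \<notin> EA" using rA(4)[of "{}"] by auto
    ultimately show ?thesis by blast
  qed
  have swA: "swappable ?E (W - {s}) x z" if x: "x \<in> A" "x \<noteq> r" for x
  proof -
    have "swappable EA (W - B - {r}) x z"
      using x z rA(2) join.hyps(3) join.prems(1) by (intro join.IH(1)) blast+
    then have "swappable (EA \<union> (EB \<union> {{r, s}})) (W - {s}) x z"
    proof (rule swappable_lift)
      show "e \<inter> (W - B - {r}) = {}" if "e \<in> EB \<union> {{r, s}}" for e
        using that sB(2,3) by blast
      show "EA \<inter> (EB \<union> {{r, s}}) = {}"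
        using EAB rA(3) rs(2) by blast
      show "W - B - {r} \<subseteq> W - {s}" using sB(2) by blast
    qed
    then show ?thesis by (simp add: Un_assoc)
  qed
  have swB: "swappable ?E (W - {s}) x z" if x: "x \<in> W" "x \<notin> A" "x \<noteq> s" for x
  proof -
    have "swappable EB (W - A - {s}) x z"
      using x z sB(2) join.hyps(3) join.prems(1) by (intro join.IH(2)) blast+
    then have "swappable (EB \<union> (EA \<union> {{r, s}})) (W - {s}) x z"
    proof (rule swappable_lift)
      show "e \<inter> (W - A - {s}) = {}" if "e \<in> EA \<union> {{r, s}}" for e
        using that rA(2,3) by blast
      show "EB \<inter> (EA \<union> {{r, s}}) = {}"
        using EAB sB(3) rs(1) by blast
      show "W - A - {s} \<subseteq> W - {s}" by blast
    qed
    then show ?thesis by (simp add: Un_ac)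
  qed
  have to_z: "swappable ?E (W - {s}) x z" if "x \<in> ?S" for x
  proof (cases "x \<in> A")
    case True
    then show ?thesis using that by (intro swA) blast+
  next
    case False
    then show ?thesis using that by (intro swB) blast+
  qed
  \<comment> \<open>All vertices of \<open>?S\<close> are now equivalent through \<open>z\<close>;
    the permutation \<open>g\<close> adds \<open>r\<close>.\<close>
  obtain g where g: "g \<in> step_perms ?E (A \<union> B - {s})" "g r \<noteq> r"
    using rfib_move_child[OF join.hyps] by blast
  have "swappable ?E (insert r ?S) x y" if "x \<in> ?S" "y \<in> ?S" for x y
    unfolding ins using swappable_trans[OF to_z[OF that(1)] swappable_sym[OF to_z[OF that(2)]]] .
  moreover have "g \<in> step_group ?E (insert r ?S)" unfolding ins
    by (rule step_group_mono[OF _ step_group.step[OF g(1)]]) (use join.prems(1) in blast)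
  moreover note g(2)
  moreover have "\<not> (\<exists>y. ?S \<subseteq> {y})"
  proof -
    \<comment> \<open>A second element of \<open>?S\<close> besides \<open>z\<close> is a vertex of
      \<open>B\<close> other than its root.\<close>
    obtain y where "y \<in> B" "y \<noteq> s" using sB(2,7) by blast
    then have "y \<in> ?S" "z \<in> ?S" "y \<noteq> z" using z rs rA(2) sB(2) join.prems(1) by blast+
    then show ?thesis by blast
  qed
  moreover have "a \<in> insert r ?S" "b \<in> insert r ?S" using join.prems by auto
  ultimately have "swappable ?E (insert r ?S) a b" by (rule swappable_extend)
  then show ?case unfolding ins .
qed (simp_all add: single_edge_swappable)

text \<open>The non-root vertices form one class, and the permutation that moves the root adds it to
  this class.\<close>

lemma rfib_swappable:
  assumes "rfib n s V E" "V \<subset> W" "a \<in> W" "b \<in> W"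
  shows "swappable E W a b"
proof -
  have s: "s \<in> V" "V \<noteq> {s}" using rfib_basic(2,7)[OF assms(1)] .
  have ins: "insert s (W - {s}) = W" using s assms(2) by blast
  obtain g where g: "g \<in> step_perms E V" "g s \<noteq> s" using rfib_move_root[OF assms(1)] by blast
  have "swappable E (insert s (W - {s})) a b"
  proof (rule swappable_extend)
    show "swappable E (insert s (W - {s})) x y" if "x \<in> W - {s}" "y \<in> W - {s}" for x y
      by (rule swappable_mono[OF _ rfib_swappable_nonroot[OF assms(1,2) that]]) blast
    show "g \<in> step_group E (insert s (W - {s}))" unfolding ins
      by (rule step_group_mono[OF _ step_group.step[OF g(1)]]) (use assms(2) in blast)
    show "g s \<noteq> s" by (rule g(2))
    show "\<not> (\<exists>y. W - {s} \<subseteq> {y})" using s assms(2) by blast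
  qed (use assms ins in auto)
  then show ?thesis unfolding ins .
qed

section \<open>Degrees and the position of the root\<close>

lemma incident_join:
  assumes "\<And>e. e \<in> EA \<Longrightarrow> e \<subseteq> A" "\<And>e. e \<in> EB \<Longrightarrow> e \<subseteq> B" "finite EA" "A \<inter> B = {}"
    and "r \<in> A" "s \<in> B" "x \<in> A"
  shows "card {e \<in> EA \<union> EB \<union> {{r, s}}. x \<in> e} = card {e \<in> EA. x \<in> e} + (if x = r then 1 else 0)"
proof -
  have "x \<notin> e" if "e \<in> EB" for e using assms(2)[OF that] assms(4,7) by blast
  moreover have "x \<noteq> s" using assms(4,6,7) by blast
  ultimately have "{e \<in> EA \<union> EB \<union> {{r, s}}. x \<in> e} =
      {e \<in> EA. x \<in> e} \<union> (if x = r then {{r, s}} else {})" by auto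
  moreover have "{r, s} \<notin> EA" using assms(1)[of "{r, s}"] assms(4,6) by blast
  ultimately show ?thesis using assms(3) by simp
qed

text \<open>Each join raises the degree of the kept root by one, and that of \<open>r\<close> at
  most up to the same bound. The maximum with 1 accounts for T_1, where \<open>n - 1\<close> is
  0.\<close>

lemma rfib_incident:
  assumes "rfib n s V E" "x \<in> V"
  shows "card {e \<in> E. x \<in> e} \<le> max 1 (n - 1)" "x = s \<Longrightarrow> card {e \<in> E. x \<in> e} = max 1 (n - 1)"
  using assms
proof (induction arbitrary: x rule: rfib.induct)
  case (base1 a b)
  { fix x assume "x \<in> {a, b}"
    then have "{e \<in> {{a, b}}. x \<in> e} = {{a, b}}" by auto
    then have "card {e \<in> {{a, b}}. x \<in> e} = 1" by simp }
  note * = this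
  { case 1 then show ?case using * by simp
  next
    case 2 then show ?case using * by simp }
next
  case (base2 a b)
  { fix x assume "x \<in> {a, b}"
    then have "{e \<in> {{a, b}}. x \<in> e} = {{a, b}}" by auto
    then have "card {e \<in> {{a, b}}. x \<in> e} = 1" by simp }
  note * = this
  { case 1 then show ?case using * by simp
  next
    case 2 then show ?case using * by simp }
next
  case (join n r A EA s B EB)
  note rA = rfib_basic[OF join.hyps(1)] and sB = rfib_basic[OF join.hyps(2)]
  have A: "card {e \<in> EA \<union> EB \<union> {{r, s}}. x \<in> e} = card {e \<in> EA. x \<in> e} + (if x = r then 1 else 0)"
    if "x \<in> A" for x
    using rA(3) sB(3) rA(5) join.hyps(3) rA(2) sB(2) that by (rule incident_join)
  have "card {e \<in> EB \<union> EA \<union> {{s, r}}. x \<in> e} = card {e \<in> EB. x \<in> e} + (if x = s then 1 else 0)"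
    if "x \<in> B" for x
    by (rule incident_join[OF sB(3) rA(3) sB(5) _ sB(2) rA(2) that]) (use join.hyps(3) in blast)+
  then have B: "card {e \<in> EA \<union> EB \<union> {{r, s}}. x \<in> e} = card {e \<in> EB. x \<in> e} + (if x = s then 1 else 0)"
    if "x \<in> B" for x using that by (simp add: Un_commute insert_commute)
  {
    case 1
    then show ?case
    proof
      assume "x \<in> A"
      then show ?thesis using A[OF \<open>x \<in> A\<close>] join.IH(1)[OF \<open>x \<in> A\<close>] by (simp add: max_def split: if_splits)
    next
      assume "x \<in> B"
      then show ?thesis using B[OF \<open>x \<in> B\<close>] join.IH(3)[OF \<open>x \<in> B\<close>] by (simp add: max_def split: if_splits)
    qed
  next
    case 2
    then show ?case using B join.IH(4)[of x] sB(2) by simp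
  }
qed

text \<open>A vertex of maximum degree is the recursive root, except in the trees with at most four
  vertices, where symmetry makes the other candidate a root too.\<close>

lemma fib_tree_rfib:
  assumes "fib_tree i G" "max_degree_vertex G x"
  shows "rfib i x (verts G) (edges G)"
  using assms
proof (induction arbitrary: x rule: fib_tree.induct)
  case (one a b)
  then show ?case using rfib.base1[of a b] rfib.base1[of b a]
    by (auto simp: max_degree_vertex_def insert_commute)
next
  case (two a b)
  then show ?case using rfib.base2[of a b] rfib.base2[of b a]
    by (auto simp: max_degree_vertex_def insert_commute numeral_2_eq_2)
next
  case (join i A B r s)
  obtain n where n: "i = Suc (Suc n)" using join.hyps(1) by (metis add_2_eq_Suc le_Suc_ex)
  have A: "rfib (Suc n) r (verts A) (edges A)" using join.IH(1)[OF join.hyps(5)] by (simp add: n)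
  have B: "rfib (Suc (Suc n)) s (verts B) (edges B)" using join.IH(2)[OF join.hyps(6)] by (simp add: n)
  let ?V = "verts A \<union> verts B" and ?E = "edges A \<union> edges B \<union> {{r, s}}"
  have T: "rfib (Suc (Suc (Suc n))) s ?V ?E" using A B join.hyps(4) by (rule rfib.join)
  have x: "x \<in> ?V" and max: "card {e \<in> ?E. y \<in> e} \<le> card {e \<in> ?E. x \<in> e}" if "y \<in> ?V" for y
    using join.prems that by (auto simp: max_degree_vertex_def degree_def)
  note rA = rfib_basic[OF A] and sB = rfib_basic[OF B]
  have "s \<in> ?V" using sB(2) by blast
  have "x \<in> ?V" using join.prems by (simp add: max_degree_vertex_def)
  \<comment> \<open>The root of T_{n+3} has degree n + 2. In \<open>B\<close> only \<open>s\<close>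
    reaches it; in \<open>A\<close> only \<open>r\<close> can, and only if \<open>A\<close> is a
    single edge with \<open>n = 0\<close>.\<close>
  have deg: "n + 2 \<le> card {e \<in> ?E. x \<in> e}"
    using max[OF \<open>s \<in> ?V\<close>] rfib_incident(2)[OF T \<open>s \<in> ?V\<close>] by simp
  have "x = s \<or> x = r \<and> n = 0"
  proof (cases "x \<in> verts A")
    case True
    have "card {e \<in> ?E. x \<in> e} = card {e \<in> edges A. x \<in> e} + (if x = r then 1 else 0)"
      using rA(3) sB(3) rA(5) join.hyps(4) rA(2) sB(2) True by (rule incident_join)
    then show ?thesis using rfib_incident(1)[OF A True] deg by (auto simp: max_def split: if_splits)
  next
    case False
    then have "x \<in> verts B" using \<open>x \<in> ?V\<close> by blast
    have "card {e \<in> edges B \<union> edges A \<union> {{s, r}}. x \<in> e} =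
        card {e \<in> edges B. x \<in> e} + (if x = s then 1 else 0)"
      by (rule incident_join[OF sB(3) rA(3) sB(5) _ sB(2) rA(2) \<open>x \<in> verts B\<close>])
        (use join.hyps(4) in blast)+
    then show ?thesis using rfib_incident(1)[OF B \<open>x \<in> verts B\<close>] deg
      by (simp add: Un_commute insert_commute split: if_splits)
  qed
  then show ?case
  proof
    assume "x = s"
    then show ?thesis using T by (simp add: n)
  next
    \<comment> \<open>In T_3 both parts are single edges, so their roles can be exchanged and
      \<open>r\<close> becomes the root.\<close>
    assume "x = r \<and> n = 0"
    then have "rfib (Suc (Suc (Suc 0))) x (verts B \<union> verts A) (edges B \<union> edges A \<union> {{s, x}})"
      using A B join.hyps(4) by (intro rfib.join) (auto simp: rfib_1_iff_2)
    then show ?thesis using \<open>x = r \<and> n = 0\<close> by (simp add: n Un_commute insert_commute)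
  qed
qed

section \<open>From vertex permutations to label permutations\<close>

context
  fixes G :: "'a ugraph" and v :: "nat \<Rightarrow> 'a" and n :: nat and W u
  assumes G: "simple_graph G" and v: "labelling G v"
  defines "n \<equiv> card (verts G)" and "W \<equiv> verts G" and "u \<equiv> inv_into {1..card (verts G)} v"
begin

lemma bij_v: "bij_betw v {1..n} W" and bij_u: "bij_betw u W {1..n}"
  using v by (simp_all add: labelling_def n_def W_def u_def bij_betw_inv_into)

lemma v_u: "x \<in> W \<Longrightarrow> v (u x) = x" and u_v: "i \<in> {1..n} \<Longrightarrow> u (v i) = i"
  using bij_v by (simp_all add: u_def n_def bij_betw_inv_into_left bij_betw_inv_into_right)

lemma in_W: "i \<in> {1..n} \<Longrightarrow> v i \<in> W" and u_in: "x \<in> W \<Longrightarrow> u x \<in> {1..n}"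
  using bij_v bij_u by (simp_all only: bij_betwE)

lemma v_map_permutation:
  assumes "p permutes W" "i \<in> {1..n}"
  shows "v (map_permutation W u p i) = p (v i)"
proof -
  have "map_permutation W u p (u (v i)) = u (p (v i))"
    using bij_u in_W[OF assms(2)] by (intro map_permutation_apply) (auto simp: bij_betw_def)
  then show ?thesis using assms by (simp only: u_v v_u in_W permutes_in_image)
qed

text \<open>
  The inverse appears because \<open>permuted_graph G v \<sigma>\<close> moves the vertices by \<open>inv' \<sigma>\<close>.
\<close>

lemma step_perms_label:
  assumes p: "p \<in> step_perms (edges G) W"
  shows "inv' (map_permutation W u p) \<in> (\<Union>rep\<in>feasible_replacements G v. replacement_perms G v rep)"
proof -
  let ?q = "map_permutation W u p"
  obtain e e' where pW: "p permutes W" and e: "e \<in> edges G"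
    and pE: "image p ` edges G = edges G - {e} \<union> {e'}" using p by (rule step_permsE)
  have fin: "finite W" and edge: "\<And>e. e \<in> edges G \<Longrightarrow> e \<subseteq> W \<and> card e = 2"
    using G by (auto simp: simple_graph_def W_def)
  have finE: "finite (edges G)"
    by (rule finite_subset[of _ "Pow W"]) (use edge fin in auto)
  have injp: "inj p" using pW by (rule permutes_inj)
  have "e' \<in> image p ` edges G" unfolding pE by simp
  then obtain d where d: "e' = p ` d" "d \<in> edges G" by (rule imageE)
  have "e' \<subseteq> W"
    unfolding d(1) using image_mono[of d W p] edge[OF d(2)] permutes_image[OF pW] by simp
  moreover have "card e' = 2"
    unfolding d(1) using edge[OF d(2)] card_image[OF inj_on_subset[OF injp subset_UNIV]] by simp
  ultimately have e': "e' \<subseteq> W" "card e' = 2" .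
  have "inj_on (image p) (edges G)"
    using injp by (auto intro!: inj_onI simp: inj_image_eq_iff)
  then have "card (edges G - {e} \<union> {e'}) = card (edges G)"
    unfolding pE[symmetric] by (rule card_image)
  then have ne: "e' = e \<or> e' \<notin> edges G"
  proof (rule contrapos_pp)
    assume "\<not> (e' = e \<or> e' \<notin> edges G)"
    then have "edges G - {e} \<union> {e'} = edges G - {e}" by blast
    then show "card (edges G - {e} \<union> {e'}) \<noteq> card (edges G)"
      using card_Diff1_less[OF finE e] by simp
  qed
  have iso: "graph_iso (replace_edge G e e') G"
  proof -
    \<comment> \<open>Since \<open>p\<close> maps \<open>G\<close> onto the graph after the
      replacement, its inverse is the required isomorphism back to \<open>G\<close>.\<close>
    have "bij_betw (inv' p) (verts G) (verts G)"
      using permutes_imp_bij[OF permutes_inv[OF pW]] by (simp add: W_def)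
    moreover have "edges G = image (inv' p) ` (edges G - {e} \<union> {e'})"
      unfolding pE[symmetric] by (simp add: image_comp o_def injp)
    ultimately show ?thesis unfolding graph_iso_def by (auto simp: replace_edge_def)
  qed
  have "feasible G e e'"
    using e e' ne iso by (auto simp: feasible_def complement_def W_def)
  moreover have vu: "v ` u ` c = c" if "c \<subseteq> W" for c
    using that v_u by (force simp: image_comp)
  moreover have uc: "u ` c \<subseteq> {1..n}" if "c \<subseteq> W" for c
    using that u_in by blast
  moreover have "e \<subseteq> W" using edge e by blast
  ultimately have rep: "(u ` e, u ` e') \<in> feasible_replacements G v"
    using e'(1) by (auto simp: feasible_replacements_def n_def)
  have q: "?q permutes {1..n}" by (rule map_permutation_permutes[OF bij_u pW])
  have inv: "inv' (inv' ?q) = ?q" using q by (rule permutes_inv_inv)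
  \<comment> \<open>The left side is the edge set of \<open>permuted_graph G v (inv' ?q)\<close>
    after cancelling the double inverse.\<close>
  have "{{v (?q i), v (?q j)} | i j. {i, j} \<in> label_edges G v} = image p ` edges G"
  proof (intro equalityI subsetI)
    fix c assume "c \<in> {{v (?q i), v (?q j)} | i j. {i, j} \<in> label_edges G v}"
    then obtain i j where c: "c = {v (?q i), v (?q j)}" "{i, j} \<in> label_edges G v" by blast
    then have ij: "i \<in> {1..n}" "j \<in> {1..n}" "{v i, v j} \<in> edges G"
      by (auto simp: label_edges_def n_def doubleton_eq_iff insert_commute)
    then have "c = p ` {v i, v j}" using c(1) v_map_permutation[OF pW] by simp
    then show "c \<in> image p ` edges G" using ij(3) by blast
  next
    fix c assume "c \<in> image p ` edges G"
    then obtain d where d: "c = p ` d" "d \<in> edges G" by (rule imageE)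
    then obtain a b where ab: "d = {a, b}" "a \<in> W" "b \<in> W"
      using edge[OF d(2)] by (auto simp: card_2_iff)
    have "v (?q (u a)) = p a" "v (?q (u b)) = p b"
      using v_map_permutation[OF pW] u_in v_u ab by simp_all
    moreover have "{u a, u b} \<in> label_edges G v"
      unfolding label_edges_def mem_Collect_eq n_def[symmetric]
      using u_in[OF ab(2)] u_in[OF ab(3)] v_u[OF ab(2)] v_u[OF ab(3)] d(2)
      by (intro exI[of _ "u a"] exI[of _ "u b"]) (simp add: ab(1))
    ultimately show "c \<in> {{v (?q i), v (?q j)} | i j. {i, j} \<in> label_edges G v}"
      unfolding d(1) ab(1) by (intro CollectI exI[of _ "u a"] exI[of _ "u b"]) simp
  qed
  then have "permuted_graph G v (inv' ?q) = replace_edge G (v ` u ` e) (v ` u ` e')"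
    using vu \<open>e \<subseteq> W\<close> e'(1) by (simp add: permuted_graph_def replace_edge_def inv pE)
  then have "inv' ?q \<in> replacement_perms G v (u ` e, u ` e')"
    using permutes_inv[OF q] by (simp add: replacement_perms_def sym_group_carrier n_def)
  then show ?thesis using rep by blast
qed

lemma amoeba_group_subgroup: "subgroup (amoeba_group G v) (sym_group n)"
  unfolding amoeba_group_def n_def
  by (rule group.generate_is_subgroup[OF sym_group_is_group]) (auto simp: replacement_perms_def)

text \<open>Transport along the labelling is a homomorphism on the permutations of \<open>W\<close>.
  For a generator it is the inverse of the transported permutation that realises a replacement, so
  closure under inverses is used.\<close>

lemma step_group_label:
  assumes "p \<in> step_group (edges G) W"
  shows "map_permutation W u p \<in> amoeba_group G v"
proof -
  have inj: "inj_on u W" using bij_u by (rule bij_betw_imp_inj_on)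
  have inv_closed: "inv' q \<in> amoeba_group G v" if "q \<in> amoeba_group G v" for q
    using subgroup.m_inv_closed[OF amoeba_group_subgroup that]
      subgroup.mem_carrier[OF amoeba_group_subgroup that] by simp
  show ?thesis using assms
  proof (induction rule: step_group.induct)
    case step_id
    show ?case using subgroup.one_closed[OF amoeba_group_subgroup]
      by (simp only: map_permutation_id'[OF inj] sym_group_one)
  next
    case (step p)
    have "inv' (map_permutation W u p) \<in> amoeba_group G v"
      unfolding amoeba_group_def by (rule generate.incl[OF step_perms_label[OF step]])
    then have "inv' (inv' (map_permutation W u p)) \<in> amoeba_group G v" by (rule inv_closed)
    moreover have "p permutes W" using step by (rule step_permsE)
    ultimately show ?case using permutes_inv_inv[OF map_permutation_permutes[OF bij_u]] by simp
  next
    case (comp p q)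
    have "map_permutation W u (p \<circ> q) = map_permutation W u p \<circ> map_permutation W u q"
      using inj step_group_permutes[OF comp.hyps(2)] by (rule map_permutation_compose')
    then show ?case
      using subgroup.m_closed[OF amoeba_group_subgroup comp.IH] by (simp only: sym_group_mult)
  next
    case (inv p)
    have p: "p permutes W" using inv.hyps by (rule step_group_permutes)
    have "inv' (map_permutation W u p) = map_permutation W u (inv' p)"
      using map_permutation_compose'[OF inj p, of "inv' p"]
        map_permutation_compose'[OF inj permutes_inv[OF p], of p] permutes_inv_o[OF p]
        map_permutation_id'[OF inj]
      by (intro inv_unique_comp) simp_all
    then show ?case using inv_closed[OF inv.IH] by simp
  qed
qed

text \<open>Every permutation of the labels is a product of transpositions, and each of these is the
  transport of a transposition of vertices.\<close>

lemma amoeba_group_full: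
  assumes "\<And>a b. a \<in> W \<Longrightarrow> b \<in> W \<Longrightarrow> swappable (edges G) W a b"
  shows "amoeba_group G v = carrier (sym_group n)"
proof
  show "amoeba_group G v \<subseteq> carrier (sym_group n)"
    by (rule subgroup.subset[OF amoeba_group_subgroup])
  show "carrier (sym_group n) \<subseteq> amoeba_group G v"
  proof
    fix q assume "q \<in> carrier (sym_group n)"
    then have "q permutes {1..n}" by (simp add: sym_group_carrier)
    from this finite_atLeastAtMost show "q \<in> amoeba_group G v"
    proof (induction rule: permutes_induct)
      case id
      then show ?case
        using subgroup.one_closed[OF amoeba_group_subgroup] by (simp only: sym_group_one)
    next
      case (swap i j q)
      have "map_permutation W u (transpose (v i) (v j)) = transpose (u (v i)) (u (v j))"
        using bij_betw_imp_inj_on[OF bij_u] in_W swap(1,2) by (intro map_permutation_transpose) simp_all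
      then have "map_permutation W u (transpose (v i) (v j)) = transpose i j"
        using swap(1,2) by (simp only: u_v)
      then have "transpose i j \<in> amoeba_group G v"
        using step_group_label[of "transpose (v i) (v j)"] assms in_W swap(1,2)
        by (simp add: swappable_def)
      then show ?case
        using subgroup.m_closed[OF amoeba_group_subgroup _ swap.IH] by (simp only: sym_group_mult)
    qed
  qed
qed

end

section \<open>The tree with isolated vertices added\<close>

lemma local_amoebaI:
  assumes "simple_graph G" "\<And>a b. a \<in> verts G \<Longrightarrow> b \<in> verts G \<Longrightarrow> swappable (edges G) (verts G) a b"
  shows "local_amoeba G"
  unfolding local_amoeba_def using amoeba_group_full[OF assms(1) _ assms(2)] assms(1) by blast

theorem theorem4p10:
  fixes i :: nat and G :: "'a ugraph"
  assumes "i \<ge> 1" and "fib_tree i G"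
  shows "global_amoeba G"
  unfolding global_amoeba_def
proof (intro exI allI impI)
  \<comment> \<open>The threshold is 1: a single isolated vertex already serves as the spare vertex
    and makes the inclusion \<open>sub\<close> strict.\<close>
  fix t :: nat assume t: "t \<ge> 1"
  obtain s where "max_degree_vertex G s"
    using max_degree_vertex_exists fib_tree_verts[OF assms(2)] by metis
  from fib_tree_rfib[OF assms(2) this] have T: "rfib i s (verts G) (edges G)" .
  let ?H = "add_isolated G t"
  have T': "rfib i (Inl s :: 'a + nat) (Inl ` verts G) (edges ?H)"
    using rfib_image[OF T, of "Inl :: 'a \<Rightarrow> 'a + nat"] by (simp add: add_isolated_def)
  have sub: "Inl ` verts G \<subset> verts ?H"
  proof (rule psubsetI)
    have "Inr 0 \<in> verts ?H" using t by (simp add: add_isolated_def)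
    then show "Inl ` verts G \<noteq> verts ?H" by blast
  qed (simp add: add_isolated_def)
  have "simple_graph ?H"
    using rfib_basic(1)[OF T] rfib_basic(3,4)[OF T'] sub
    by (auto simp: simple_graph_def add_isolated_def)
  then show "local_amoeba ?H" by (rule local_amoebaI) (rule rfib_swappable[OF T' sub])
qed

end
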